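(* Let $0<\alpha<n$, $1<q\le p<\infty$, $1<t\le s<\infty$ with $\frac1s=\frac1p-\frac\alpha n$ and $\frac ts=\frac qp$. Then for every $f\in\mathcal M^p_q$ the limit \[ I_{\alpha,{\rm dyadic}}f(x)=\lim_{M\to\infty}\sum_{\varepsilon\in E}\sum_{j=-M}^{M}\sum_{Q\in\mathcal D_j}|Q|^{\alpha/n}\langle f,h^\varepsilon_Q\rangle h^\varepsilon_Q(x) \] exists for almost every $x\in\mathbb R^n$, and $\|I_{\alpha,{\rm dyadic}}f\|_{\mathcal M^s_t}\lesssim\|f\|_{\mathcal M^p_q}$ with implicit constant depending only on $n,p,q,s,t,\alpha$.
   Context: Dyadic cubes: $Q_{jm}=\prod_{\nu=1}^n[m_\nu2^{-j},(m_\nu+1)2^{-j})$, $\mathcal D_j=\{Q_{jm}:m\in\mathbb Z^n\}$, $\mathcal D=\bigcup_j\mathcal D_j$. Haar functions: $h^{\epsilon_i}(t)=\chi_{[0,1)}(2t)+(-1)^{\epsilon_i}\chi_{[1,2)}(2t)$ for $\epsilon_i\in\{0,1\}$; $E=\{0,1\}^n\setminus\{(0,\dots,0)\}$; $h^\varepsilon(x)=\prod_i h^{\varepsilon_i}(x_i)$; $h^\varepsilon_{Q_{jm}}(x)=2^{jn/2}h^\varepsilon(2^jx-m)$. $\langle f,g\rangle=\int fg$. Morrey space: for $1\le q\le p<\infty$, $\|f\|_{\mathcal M^p_q}=\sup_{Q\in\mathcal D}|Q|^{1/p-1/q}(\int_Q|f|^q)^{1/q}$, $\mathcal M^p_q=\{f\in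 L^q_{\rm loc}:\|f\|_{\mathcal M^p_q}<\infty\}$. *)

theory Defs
  imports "HOL-Analysis.Analysis"
begin

definition dyadic_cube :: "int \<Rightarrow> ('n::finite \<Rightarrow> int) \<Rightarrow> (real^'n) set" where
  "dyadic_cube j m = {x. \<forall>i. real_of_int (m i) * 2 powr (- real_of_int j) \<le> x $ i
                          \<and> x $ i < (real_of_int (m i) + 1) * 2 powr (- real_of_int j)}"

definition dyadic_cubes :: "(real^'n::finite) set set" where
  "dyadic_cubes = {dyadic_cube j m | j m. True}"

text \<open>One-dimensional Haar factor h^e, e in {0,1} encoded as bool (True = 1).\<close>
definition haar1 :: "bool \<Rightarrow> real \<Rightarrow> real" where
  "haar1 e t = indicator {0..<1} (2 * t) + (if e then -1 else 1) * indicator {1..<2} (2 * t)"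

definition haar_sigs :: "('n::finite \<Rightarrow> bool) set" where
  "haar_sigs = {e. e \<noteq> (\<lambda>_. False)}"

definition haar_fun :: "('n::finite \<Rightarrow> bool) \<Rightarrow> int \<Rightarrow> ('n \<Rightarrow> int) \<Rightarrow> real^'n \<Rightarrow> real" where
  "haar_fun e j m x = 2 powr (real_of_int j * real CARD('n) / 2) *
      (\<Prod>i\<in>UNIV. haar1 (e i) (2 powr (real_of_int j) * x $ i - real_of_int (m i)))"

definition pairing :: "(real^'n::finite \<Rightarrow> real) \<Rightarrow> (real^'n \<Rightarrow> real) \<Rightarrow> real" where
  "pairing f g = (LINT y|lebesgue. f y * g y)"

definition Lq_loc :: "real \<Rightarrow> (real^'n::finite \<Rightarrow> real) set" where
  "Lq_loc q = {f. f \<in> borel_measurable lebesgue \<and>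
       (\<forall>K. compact K \<longrightarrow> set_integrable lebesgue K (\<lambda>x. \<bar>f x\<bar> powr q))}"

definition morrey_vals :: "real \<Rightarrow> real \<Rightarrow> (real^'n::finite \<Rightarrow> real) \<Rightarrow> real set" where
  "morrey_vals p q f = (\<lambda>Q. measure lebesgue Q powr (1/p - 1/q) *
       (LINT x:Q|lebesgue. \<bar>f x\<bar> powr q) powr (1/q)) ` dyadic_cubes"

definition morrey_norm :: "real \<Rightarrow> real \<Rightarrow> (real^'n::finite \<Rightarrow> real) \<Rightarrow> real" where
  "morrey_norm p q f = Sup (morrey_vals p q f)"

definition morrey_space :: "real \<Rightarrow> real \<Rightarrow> (real^'n::finite \<Rightarrow> real) set" where
  "morrey_space p q = {f. f \<in> Lq_loc q \<and> bdd_above (morrey_vals p q f)}"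

text \<open>Partial sums: sum over e in E, j from -M to M, and Q in D_j (the sum over m in Z^n
  is an infinite sum; pointwise at most one term is nonzero).\<close>
definition frac_partial :: "real \<Rightarrow> (real^'n::finite \<Rightarrow> real) \<Rightarrow> nat \<Rightarrow> real^'n \<Rightarrow> real" where
  "frac_partial \<alpha> f M x = (\<Sum>e\<in>haar_sigs. \<Sum>j\<in>{- int M..int M}.
      infsum (\<lambda>m. measure lebesgue (dyadic_cube j m) powr (\<alpha> / real CARD('n)) *
                   pairing f (haar_fun e j m) * haar_fun e j m x) UNIV)"

definition frac_dyadic :: "real \<Rightarrow> (real^'n::finite \<Rightarrow> real) \<Rightarrow> real^'n \<Rightarrow> real" where
  "frac_dyadic \<alpha> f x = lim (\<lambda>M. frac_partial \<alpha> f M x)"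

end

theory Submission
  imports Defs
begin

text \<open>
  The part of the sum at scale \<open>j\<close> is at most a constant times \<open>2\<^sup>-\<^sup>j\<^sup>\<alpha> A\<^sub>j(x)\<close>, where \<open>A\<^sub>j(x)\<close> is the average
  of \<open>\<bar>f\<bar>\<close> over the cube of side \<open>2\<^sup>-\<^sup>j\<close> containing \<open>x\<close>. Besides \<open>A\<^sub>j \<le> Mf\<close> (the dyadic maximal function)
  the Morrey norm \<open>N\<close> of \<open>f\<close> gives \<open>A\<^sub>j \<le> 2 powr (j n / p) N\<close>. Summing the better of the two bounds over
  all \<open>j\<close>, as Hedberg does, the series converges absolutely wherever \<open>Mf\<close> is finite, with sum at most a
  constant times \<open>(Mf) powr (p/s) N powr (1 - p/s)\<close>. On a cube \<open>Q\<close> the averages over cubes containing \<open>Q\<close>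
  are bounded by \<open>\<bar>Q\<bar> powr (-1/p) N\<close>, and those over subcubes are controlled in \<open>L\<^sup>q(Q)\<close> by Doob's inequality.
\<close>

section \<open>Dyadic cubes and averages\<close>

text \<open>The index of the unique cube of scale \<open>j\<close> containing \<open>x\<close>.
  Membership becomes an equation, so that disjointness, covering and nesting of cubes turn into
  facts about floors.\<close>

definition cell :: "int \<Rightarrow> real^'n::finite \<Rightarrow> ('n \<Rightarrow> int)" where
  "cell j x = (\<lambda>i. \<lfloor>2 powr real_of_int j * x $ i\<rfloor>)"

lemma mem_dyadic_cube_iff: "x \<in> dyadic_cube j m \<longleftrightarrow> cell j x = m"
proof -
  have "(real_of_int a * 2 powr - real_of_int j \<le> y \<and> y < (real_of_int a + 1) * 2 powr - real_of_int j)
      \<longleftrightarrow> \<lfloor>2 powr real_of_int j * y\<rfloor> = a" for a y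
    by (simp add: floor_eq_iff powr_minus field_simps)
  then show ?thesis
    by (simp add: dyadic_cube_def cell_def fun_eq_iff)
qed

text \<open>Dividing the finer floor by a power of two with remainder gives the coarser floor, so
  the fine index determines the coarse one. This is the nesting of dyadic cubes.\<close>

lemma cell_mono:
  assumes "j \<le> j'" "cell j' x = cell j' y"
  shows "cell j x = cell j y"
proof -
  have *: "\<lfloor>2 powr real_of_int j * z\<rfloor> = \<lfloor>2 powr real_of_int j' * z\<rfloor> div 2 ^ nat (j' - j)" for z :: real
  proof -
    have "2 powr real_of_int j' = 2 powr real_of_int j * 2 ^ nat (j' - j)"
      using assms(1) by (simp add: powr_realpow[symmetric] powr_add[symmetric])
    then have "2 powr real_of_int j * z = 2 powr real_of_int j' * z / real_of_int (2 ^ nat (j' - j))"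
      by simp
    then show ?thesis
      using floor_divide_real_eq_div[of "2 ^ nat (j' - j)" "2 powr real_of_int j' * z"] by simp
  qed
  show ?thesis
    using assms(2) unfolding cell_def fun_eq_iff * by simp
qed

lemma dyadic_cube_borel [measurable]: "dyadic_cube j m \<in> sets borel"
  unfolding dyadic_cube_def by measurable

lemma dyadic_cube_lebesgue [measurable]: "dyadic_cube j m \<in> sets lebesgue"
  using sets_completionI_sets[of _ lborel] dyadic_cube_borel by simp

text \<open>The half-open cube is squeezed between an open and a closed box of equal volume, which
  fixes its measure; the closed box is also the compact superset used for local
  integrability.\<close>

lemma dyadic_cube_between:
  fixes j :: int and m :: "'n::finite \<Rightarrow> int"
  defines "a \<equiv> (\<chi> i. real_of_int (m i) * 2 powr - real_of_int j)"
    and "b \<equiv> (\<chi> i. (real_of_int (m i) + 1) * 2 powr - real_of_int j)"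
  shows "box a b \<subseteq> dyadic_cube j m" "dyadic_cube j m \<subseteq> cbox a b"
    "emeasure lborel (box a b) = ennreal (2 powr (- real_of_int j * real CARD('n)))"
    "emeasure lborel (cbox a b) = ennreal (2 powr (- real_of_int j * real CARD('n)))"
proof -
  show "box a b \<subseteq> dyadic_cube j m" "dyadic_cube j m \<subseteq> cbox a b"
    by (auto simp: mem_box_cart dyadic_cube_def a_def b_def less_imp_le)
  have le: "a \<bullet> i \<le> b \<bullet> i" if "i \<in> Basis" for i
    using that by (auto simp: Basis_vec_def inner_axis a_def b_def)
  have "(\<Prod>i\<in>Basis. (b - a) \<bullet> i) = (\<Prod>i\<in>(Basis::(real^'n) set). 2 powr - real_of_int j)"
    by (rule prod.cong) (auto simp: Basis_vec_def inner_axis a_def b_def algebra_simps)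
  also have "\<dots> = 2 powr (- real_of_int j * real CARD('n))"
    by (simp add: powr_realpow[symmetric] powr_powr)
  finally have pr: "(\<Prod>i\<in>Basis. (b - a) \<bullet> i) = 2 powr (- real_of_int j * real CARD('n))" .
  show "emeasure lborel (box a b) = ennreal (2 powr (- real_of_int j * real CARD('n)))"
    "emeasure lborel (cbox a b) = ennreal (2 powr (- real_of_int j * real CARD('n)))"
    using le pr by (simp_all add: emeasure_lborel_box emeasure_lborel_cbox)
qed

lemma emeasure_dyadic_cube:
  "emeasure lebesgue (dyadic_cube j m :: (real^'n::finite) set) = ennreal (2 powr (- real_of_int j * real CARD('n)))"
proof -
  note * = dyadic_cube_between[where j=j and m=m]
  have "emeasure lborel (dyadic_cube j m :: (real^'n) set) = ennreal (2 powr (- real_of_int j * real CARD('n)))"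
    using emeasure_mono[OF *(1), of lborel] emeasure_mono[OF *(2), of lborel]
    unfolding *(3,4) by (intro antisym) simp_all
  then show ?thesis by simp
qed

lemma measure_dyadic_cube:
  "measure lebesgue (dyadic_cube j m :: (real^'n::finite) set) = 2 powr (- real_of_int j * real CARD('n))"
  by (simp add: measure_def emeasure_dyadic_cube)

lemma dyadic_cube_subset_compact: "\<exists>K. compact K \<and> dyadic_cube j m \<subseteq> K"
  by (intro exI conjI, rule compact_cbox, rule dyadic_cube_between(2))

text \<open>Scaled coordinates of a bounded set stay in a bounded range and so have finitely many
  floors. This makes the decompositions into cubes of one scale finite.\<close>

lemma cell_bounded_finite:
  fixes S :: "(real^'n::finite) set"
  assumes "bounded S"
  shows "finite (cell j ` S)"
proof -
  from assms obtain B where B: "\<And>x. x \<in> S \<Longrightarrow> norm x \<le> B"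
    by (auto simp: bounded_iff)
  define N where "N = \<lceil>2 powr real_of_int j * B\<rceil> + 1"
  have "cell j x \<in> (UNIV \<rightarrow>\<^sub>E {-N..N})" if "x \<in> S" for x
  proof -
    have "\<bar>2 powr real_of_int j * x $ i\<bar> \<le> 2 powr real_of_int j * B" for i
      using order_trans[OF component_le_norm_cart B[OF that], of i]
      by (simp add: abs_mult)
    then have "\<bar>2 powr real_of_int j * x $ i\<bar> \<le> \<lceil>2 powr real_of_int j * B\<rceil>" for i
      by (meson le_of_int_ceiling order_trans)
    then have "- N \<le> \<lfloor>2 powr real_of_int j * x $ i\<rfloor>" "\<lfloor>2 powr real_of_int j * x $ i\<rfloor> \<le> N" for i
      by (simp_all add: N_def le_floor_iff floor_le_iff abs_le_iff) (smt (verit))+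
    then show ?thesis by (auto simp: cell_def)
  qed
  then have "cell j ` S \<subseteq> (UNIV \<rightarrow>\<^sub>E {-N..N})" by blast
  then show ?thesis by (rule finite_subset) (simp add: finite_PiE)
qed

lemma dyadic_cube_finite_cells: "finite (cell j ` dyadic_cube j' m)"
proof -
  obtain K where "compact K" "dyadic_cube j' m \<subseteq> K"
    using dyadic_cube_subset_compact by blast
  then show ?thesis
    by (intro cell_bounded_finite) (blast intro: bounded_subset compact_imp_bounded)
qed

lemma dyadic_cube_decompose:
  assumes "j0 \<le> j"
  shows "dyadic_cube j0 m0 = (\<Union>m\<in>cell j ` dyadic_cube j0 m0. dyadic_cube j m)"
  using cell_mono[OF assms] by (auto simp: mem_dyadic_cube_iff)

lemma disjoint_dyadic_cubes: "disjoint_family_on (dyadic_cube j) I"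
  by (auto simp: disjoint_family_on_def mem_dyadic_cube_iff)

section \<open>Measurability and conditional expectation at one dyadic scale\<close>

lemma cell_measurable [measurable]: "(cell j :: real^'n::finite \<Rightarrow> _) \<in> borel \<rightarrow>\<^sub>M count_space UNIV"
proof -
  have "cell j -` {m} = (dyadic_cube j m :: (real^'n) set)" for m
    by (auto simp: mem_dyadic_cube_iff)
  then show ?thesis
    by (simp add: measurable_count_space_eq2_countable)
qed

text \<open>Stands in for measurability with respect to the sigma-algebra generated by the cubes of
  scale \<open>j\<close>; larger \<open>j\<close> means a finer sigma-algebra.\<close>

definition level_fun :: "int \<Rightarrow> (real^'n::finite \<Rightarrow> 'a) \<Rightarrow> bool" where
  "level_fun j F \<longleftrightarrow> (\<forall>x y. cell j x = cell j y \<longrightarrow> F x = F y)"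

lemma level_fun_mono: "level_fun j F \<Longrightarrow> j \<le> j' \<Longrightarrow> level_fun j' F"
  unfolding level_fun_def by (intro allI impI, drule spec, drule spec, erule mp, erule cell_mono)

lemma level_fun_measurable:
  fixes F :: "real^'n::finite \<Rightarrow> real"
  assumes "level_fun j F"
  shows "F \<in> borel_measurable borel"
proof -
  \<comment> \<open>\<open>F\<close> factors through the countably-valued \<open>cell j\<close>; the
    representative chosen by \<open>SOME\<close> is irrelevant because \<open>F\<close> is constant
    on cells.\<close>
  have "F = (\<lambda>m. F (SOME x. cell j x = m)) \<circ> cell j"
    using assms unfolding level_fun_def comp_def
    by (intro ext) (metis (mono_tags, lifting) someI)
  also have "\<dots> \<in> borel_measurable borel"
    by (intro measurable_comp[OF cell_measurable]) simp
  finally show ?thesis .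
qed

text \<open>On a single cube \<open>F\<close> is a constant and can be pulled out. The cube is named
  by a point \<open>z\<close> so that this constant can be written \<open>F z\<close>.\<close>

lemma level_fun_set_integrable:
  fixes F g :: "real^'n::finite \<Rightarrow> real"
  assumes "level_fun j F" "\<And>m. set_integrable lebesgue (dyadic_cube j m) g"
  shows "set_integrable lebesgue (dyadic_cube j m) (\<lambda>x. F x * g x)"
    "(LINT x:dyadic_cube j (cell j z)|lebesgue. F x * g x) = F z * (LINT x:dyadic_cube j (cell j z)|lebesgue. g x)"
proof -
  have F: "F x = F z" if "cell j x = cell j z" for x z
    using assms(1) that unfolding level_fun_def by blast
  have *: "(LINT x:dyadic_cube j (cell j z)|lebesgue. F x * g x) = (LINT x:dyadic_cube j (cell j z)|lebesgue. F z * g x)"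
    for z
    by (intro set_lebesgue_integral_cong) (auto simp: mem_dyadic_cube_iff dest: F)
  then show "(LINT x:dyadic_cube j (cell j z)|lebesgue. F x * g x) = F z * (LINT x:dyadic_cube j (cell j z)|lebesgue. g x)"
    by simp
  have "set_integrable lebesgue (dyadic_cube j (cell j z)) (\<lambda>x. F x * g x)" for z
    using set_integrable_mult_right[OF assms(2), where a="F z"]
    by (rule set_integrable_cong[THEN iffD1, rotated 3]) (auto simp: mem_dyadic_cube_iff dest: F)
  moreover have "set_integrable lebesgue {} (\<lambda>x. F x * g x)"
    by (simp add: set_integrable_def)
  \<comment> \<open>An arbitrary index either comes from a point or gives the empty set, where
    integrability is trivial.\<close>
  moreover have "dyadic_cube j m = {} \<or> (\<exists>z. m = cell j z)"
    by (auto simp: mem_dyadic_cube_iff)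
  ultimately show "set_integrable lebesgue (dyadic_cube j m) (\<lambda>x. F x * g x)"
    by metis
qed

lemma level_fun_set_integrable_coarse:
  fixes F g :: "real^'n::finite \<Rightarrow> real"
  assumes "level_fun j F" "\<And>j m. set_integrable lebesgue (dyadic_cube j m) g" "j0 \<le> j"
  shows "set_integrable lebesgue (dyadic_cube j0 m0) (\<lambda>x. F x * g x)"
  by (subst dyadic_cube_decompose[OF assms(3)])
    (intro set_integrable_UN dyadic_cube_finite_cells level_fun_set_integrable(1) assms dyadic_cube_lebesgue)

text \<open>The prefactor is the reciprocal of the volume of the cube: this is the conditional
  expectation of \<open>g\<close> at scale \<open>j\<close>.\<close>

definition dyadic_avg :: "(real^'n::finite \<Rightarrow> real) \<Rightarrow> int \<Rightarrow> real^'n \<Rightarrow> real" where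
  "dyadic_avg g j x = 2 powr (real_of_int j * real CARD('n)) * (LINT y:dyadic_cube j (cell j x)|lebesgue. g y)"

lemma level_fun_dyadic_avg: "level_fun j (dyadic_avg g j)"
  by (auto simp: level_fun_def dyadic_avg_def)

lemma dyadic_cube_set_integrable_const:
  "set_integrable lebesgue (dyadic_cube j m) (\<lambda>x. c::real)"
  by (auto simp: set_integrable_def emeasure_dyadic_cube)

text \<open>The defining property of conditional expectation. On each cube of scale \<open>j\<close>
  both factors \<open>F\<close> and the average are constant, and volume times average is the
  integral of \<open>g\<close>; the coarser cube is a finite disjoint union of such cubes.\<close>

lemma set_integral_dyadic_avg:
  fixes F g :: "real^'n::finite \<Rightarrow> real"
  assumes F: "level_fun j F" and g: "\<And>j m. set_integrable lebesgue (dyadic_cube j m) g" and j: "j0 \<le> j"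
  shows "(LINT x:dyadic_cube j0 m0|lebesgue. F x * dyadic_avg g j x) = (LINT x:dyadic_cube j0 m0|lebesgue. F x * g x)"
proof -
  let ?I = "cell j ` dyadic_cube j0 m0"
  have FA: "level_fun j (\<lambda>x. F x * dyadic_avg g j x)"
    using F level_fun_dyadic_avg[of j g] unfolding level_fun_def by metis
  have 1: "(LINT x:dyadic_cube j (cell j z)|lebesgue. F x * dyadic_avg g j x)
      = (LINT x:dyadic_cube j (cell j z)|lebesgue. F x * g x)" for z
  proof -
    have "(LINT x:dyadic_cube j (cell j z)|lebesgue. F x * dyadic_avg g j x)
       = F z * dyadic_avg g j z * measure lebesgue (dyadic_cube j (cell j z))"
      using level_fun_set_integrable(2)[OF FA dyadic_cube_set_integrable_const[where c=1], of z]
      by (simp add: set_lebesgue_integral_def)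
    also have "\<dots> = F z * (LINT x:dyadic_cube j (cell j z)|lebesgue. g x)"
      by (simp add: measure_dyadic_cube dyadic_avg_def powr_minus)
    also have "\<dots> = (LINT x:dyadic_cube j (cell j z)|lebesgue. F x * g x)"
      by (rule level_fun_set_integrable(2)[OF F g, symmetric])
    finally show ?thesis .
  qed
  have 2: "(LINT x:dyadic_cube j0 m0|lebesgue. h x) = (\<Sum>m\<in>?I. LINT x:dyadic_cube j m|lebesgue. h x)"
    if "\<And>m. set_integrable lebesgue (dyadic_cube j m) h" for h :: "real^'n \<Rightarrow> real"
    by (subst dyadic_cube_decompose[OF j])
      (intro set_integral_finite_Union that dyadic_cube_finite_cells disjoint_dyadic_cubes dyadic_cube_lebesgue)
  have "set_integrable lebesgue (dyadic_cube j m) (\<lambda>x. F x * dyadic_avg g j x)" for m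
    using level_fun_set_integrable(1)[OF FA dyadic_cube_set_integrable_const[where c=1]] by simp
  then show ?thesis
    using level_fun_set_integrable(1)[OF F g] 1 by (auto simp: 2 intro!: sum.cong)
qed

section \<open>The dyadic maximal inequality\<close>

text \<open>Young's inequality with exponents \<open>q / (q - 1)\<close> and \<open>q\<close>. It
  yields Jensen's inequality, the potential step and the absorption in Doob's inequality.\<close>

lemma Young_powr:
  fixes a m q :: real
  assumes "1 < q" "0 \<le> m" "0 \<le> a"
  shows "m powr (q - 1) * a \<le> (1 - 1 / q) * m powr q + a powr q / q"
proof -
  have "m powr (q - 1) * a \<le> (m powr (q - 1)) powr (q / (q - 1)) / (q / (q - 1)) + a powr q / q"
    using assms by (intro Youngs_inequality) (auto simp: field_simps)
  also have "(m powr (q - 1)) powr (q / (q - 1)) = m powr q"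
    using assms by (simp add: powr_powr)
  finally show ?thesis
    using assms by (simp add: field_simps)
qed

text \<open>The potential \<open>m\<^sup>q - q' m\<^sup>q\<^sup>-\<^sup>1 a\<close> of a running maximum \<open>m\<close> decreases when \<open>m\<close> is updated by
  the current value \<open>a\<close>; it is linear in \<open>a\<close>, so the martingale property makes its integral
  decreasing along the scales.\<close>

lemma maximal_potential_step:
  fixes a m q :: real
  assumes "1 < q" "0 \<le> m" "0 \<le> a"
  shows "max m a powr q - q / (q - 1) * (max m a powr (q - 1) * a)
    \<le> m powr q - q / (q - 1) * (m powr (q - 1) * a)"
proof (cases "m \<le> a")
  \<comment> \<open>The new maximum is \<open>a\<close>, so the left side equals
    \<open>- (a powr q) / (q - 1)\<close>, and Young's inequality times \<open>q / (q - 1)\<close>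
    is what remains.\<close>
  case True
  have "q / (q - 1) * (m powr (q - 1) * a) \<le> q / (q - 1) * ((1 - 1 / q) * m powr q + a powr q / q)"
    using Young_powr[OF assms] assms(1) by (intro mult_left_mono) auto
  also have "\<dots> = m powr q + a powr q / (q - 1)"
    using assms(1) by (simp add: field_simps)
  finally have "q / (q - 1) * (m powr (q - 1) * a) \<le> m powr q + a powr q / (q - 1)" .
  moreover have "a powr (q - 1) * a = a powr q"
    using assms by (cases "a = 0") (auto simp: powr_diff)
  moreover have "q / (q - 1) * a powr q = a powr q + a powr q / (q - 1)"
    using assms(1) by (simp add: field_simps)
  ultimately show ?thesis
    using True by (simp add: max_absorb2)
qed (simp add: max_absorb1)

text \<open>A weighted Young inequality: the weight leaves coefficient 1/2 on the power of
  \<open>m\<close>, which can then be absorbed on the other side of the maximal inequality.\<close>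

lemma maximal_absorb:
  fixes g m q :: real
  assumes "1 < q" "0 \<le> m" "0 \<le> g"
  shows "q / (q - 1) * (m powr (q - 1) * g) \<le> m powr q / 2 + 2 powr (q - 1) / (q - 1) * g powr q"
proof -
  \<comment> \<open>Chosen so that \<open>d powr q = 1 / 2\<close>; the factor \<open>e\<close>
    below compensates for \<open>d\<close> in the product.\<close>
  define d :: real where "d = 2 powr (- 1 / q)"
  have d: "d powr q = 1 / 2" "d > 0" "(1 / d powr (q - 1)) powr q = 2 powr (q - 1)"
    using assms(1) by (auto simp: d_def powr_powr powr_minus_divide[symmetric])
  define e where "e = 1 / d powr (q - 1)"
  have "m powr (q - 1) * g = (d * m) powr (q - 1) * (e * g)"
    using assms d(2) by (simp add: powr_mult e_def)
  also have "\<dots> \<le> (1 - 1 / q) * (d * m) powr q + (e * g) powr q / q"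
    using assms d(2) by (intro Young_powr) (auto simp: e_def)
  also have "\<dots> = (1 - 1 / q) * (m powr q / 2) + 2 powr (q - 1) * g powr q / q"
    using assms d(1,2) d(3)[folded e_def] by (simp add: powr_mult)
  finally have "q / (q - 1) * (m powr (q - 1) * g)
      \<le> q / (q - 1) * ((1 - 1 / q) * (m powr q / 2) + 2 powr (q - 1) * g powr q / q)"
    using assms(1) by (intro mult_left_mono) auto
  also have "\<dots> = m powr q / 2 + 2 powr (q - 1) / (q - 1) * g powr q"
    using assms(1) by (simp add: field_simps)
  finally show ?thesis .
qed

section \<open>Running maxima over finitely many scales and Doob's inequality\<close>

lemma level_fun_comp: "level_fun j F \<Longrightarrow> level_fun j (\<lambda>x. h (F x))"
  unfolding level_fun_def by metis

lemma level_fun_comp2: "level_fun j F \<Longrightarrow> level_fun j G \<Longrightarrow> level_fun j (\<lambda>x. h (F x) (G x))"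
  unfolding level_fun_def by metis

text \<open>Doob's maximal function restricted to the scales \<open>j0\<close> to
  \<open>j0 + k\<close>. On a cube of scale \<open>j0\<close> it takes finitely many values, so its
  powers are integrable there; the supremum over \<open>k\<close> comes last.\<close>

primrec runmax :: "(real^'n::finite \<Rightarrow> real) \<Rightarrow> int \<Rightarrow> nat \<Rightarrow> real^'n \<Rightarrow> real" where
  "runmax g j0 0 x = dyadic_avg g j0 x"
| "runmax g j0 (Suc k) x = max (runmax g j0 k x) (dyadic_avg g (j0 + int (Suc k)) x)"

lemma level_fun_runmax: "level_fun (j0 + int k) (runmax g j0 k)"
proof (induction k)
  case 0
  have "runmax g j0 0 = dyadic_avg g j0" by auto
  then show ?case using level_fun_dyadic_avg[of j0 g] by simp
next
  case (Suc k)
  have "level_fun (j0 + int (Suc k)) (runmax g j0 k)"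
    by (rule level_fun_mono[OF Suc]) simp
  from level_fun_comp2[OF this level_fun_dyadic_avg[of "j0 + int (Suc k)" g], of max]
  show ?case by simp
qed

lemma dyadic_avg_le_runmax: "i \<le> k \<Longrightarrow> dyadic_avg g (j0 + int i) x \<le> runmax g j0 k x"
proof (induction k)
  case (Suc k)
  then show ?case by (cases "i = Suc k") (simp_all add: max.coboundedI1)
qed simp

lemma runmax_mono: "i \<le> k \<Longrightarrow> runmax g j0 i x \<le> runmax g j0 k x"
proof (induction k)
  case (Suc k)
  then show ?case by (cases "i = Suc k") (simp_all add: max.coboundedI1)
qed simp

lemma set_lborel_measurable_lebesgue: "F \<in> borel_measurable borel \<Longrightarrow> F \<in> borel_measurable lebesgue"
  by (simp add: measurable_completion)

locale dyadic_Lq =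
  fixes g :: "real^'n::finite \<Rightarrow> real" and q :: real
  assumes q: "1 < q" and nonneg: "\<And>x. 0 \<le> g x"
    and integrable_q: "\<And>j m. set_integrable lebesgue (dyadic_cube j m) (\<lambda>x. g x powr q)"
    and measurable_g: "g \<in> borel_measurable lebesgue"
begin

text \<open>Young's inequality against the constant 1 gives \<open>g x \<le> 1 + g x powr q\<close>,
  and cubes have finite measure.\<close>

lemma integrable_1: "set_integrable lebesgue (dyadic_cube j m) g"
proof -
  have "set_integrable lebesgue (dyadic_cube j m) (\<lambda>x. 1 + g x powr q)"
    by (intro set_integral_add dyadic_cube_set_integrable_const integrable_q)
  moreover have "g x \<le> 1 + g x powr q" for x
  proof -
    have "1 powr (q - 1) * g x \<le> (1 - 1 / q) * 1 powr q + g x powr q / q"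
      by (rule Young_powr) (use q nonneg in auto)
    also have "\<dots> \<le> 1 + g x powr q"
      using q mult_right_mono[of 1 q "g x powr q"] by (intro add_mono) (auto simp: field_simps)
    finally show ?thesis by simp
  qed
  moreover have "set_borel_measurable lebesgue (dyadic_cube j m) g"
    using measurable_g unfolding set_borel_measurable_def by measurable
  ultimately show ?thesis
    using nonneg by (intro set_integrable_bound[of _ _ "\<lambda>x. 1 + g x powr q" g]) auto
qed

lemma dyadic_avg_nonneg: "0 \<le> dyadic_avg g j x"
  unfolding dyadic_avg_def set_lebesgue_integral_def
  by (intro mult_nonneg_nonneg Bochner_Integration.integral_nonneg) (auto simp: nonneg)

lemma runmax_nonneg: "0 \<le> runmax g j0 k x"
  by (induction k) (simp_all add: dyadic_avg_nonneg le_max_iff_disj)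

text \<open>Jensen's inequality, obtained by averaging Young's inequality with \<open>m\<close>
  equal to the average \<open>c\<close> itself and absorbing
  \<open>(1 - 1 / q) * c powr q\<close>.\<close>

lemma dyadic_avg_powr_le:
  "dyadic_avg g j x powr q \<le> dyadic_avg (\<lambda>x. g x powr q) j x"
proof (cases "dyadic_avg g j x = 0")
  case True
  then show ?thesis
    unfolding dyadic_avg_def set_lebesgue_integral_def
    by simp
next
  case False
  define c where "c = dyadic_avg g j x"
  define Q where "Q = dyadic_cube j (cell j x)"
  define V where "V = 2 powr (real_of_int j * real CARD('n))"
  have c: "c > 0" using False dyadic_avg_nonneg[of j x] by (simp add: c_def)
  have V: "V > 0" "V * measure lebesgue Q = 1"
    by (simp_all add: V_def Q_def measure_dyadic_cube powr_minus)
  have const: "(LINT y:Q|lebesgue. b) = b * measure lebesgue Q" for b :: real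
    by (simp add: set_lebesgue_integral_def)
  have "c powr (q - 1) * (LINT y:Q|lebesgue. g y) = (LINT y:Q|lebesgue. c powr (q - 1) * g y)"
    by simp
  also have "\<dots> \<le> (LINT y:Q|lebesgue. (1 - 1 / q) * c powr q + (1 / q) * g y powr q)"
    using Young_powr[OF q, of c] c nonneg
    by (intro set_integral_mono set_integral_add set_integrable_mult_right)
       (auto simp: Q_def integrable_1 integrable_q dyadic_cube_set_integrable_const)
  also have "\<dots> = (1 - 1 / q) * c powr q * measure lebesgue Q + (1 / q) * (LINT y:Q|lebesgue. g y powr q)"
    by (subst set_integral_add)
       (auto simp: Q_def integrable_q dyadic_cube_set_integrable_const set_integrable_divide const[unfolded Q_def])
  finally have "V * (c powr (q - 1) * (LINT y:Q|lebesgue. g y))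
      \<le> V * ((1 - 1 / q) * c powr q * measure lebesgue Q + (1 / q) * (LINT y:Q|lebesgue. g y powr q))"
    using V by (intro mult_left_mono) auto
  also have "\<dots> = (1 - 1 / q) * c powr q * (V * measure lebesgue Q) + (1 / q) * (V * (LINT y:Q|lebesgue. g y powr q))"
    by (simp add: algebra_simps)
  also have "V * (c powr (q - 1) * (LINT y:Q|lebesgue. g y)) = c powr (q - 1) * c"
    by (simp add: c_def dyadic_avg_def V_def Q_def)
  also have "c powr (q - 1) * c = c powr q"
    using c by (simp add: powr_diff)
  also have "V * measure lebesgue Q = 1" by (rule V)
  also have "V * (LINT y:Q|lebesgue. g y powr q) = dyadic_avg (\<lambda>x. g x powr q) j x"
    by (simp add: dyadic_avg_def V_def Q_def)
  finally show ?thesis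
    using q unfolding c_def[symmetric] by (simp add: field_simps)
qed

lemma runmax_integrable:
  "set_integrable lebesgue (dyadic_cube j0 m) (\<lambda>x. runmax g j0 k x powr q)"
  "set_integrable lebesgue (dyadic_cube j0 m) (\<lambda>x. runmax g j0 k x powr (q - 1) * g x)"
  "set_integrable lebesgue (dyadic_cube j0 m) (\<lambda>x. runmax g j0 k x powr (q - 1) * dyadic_avg g (j0 + int k) x)"
  "set_integrable lebesgue (dyadic_cube j0 m) (\<lambda>x. runmax g j0 k x powr (q - 1) * dyadic_avg g (j0 + int (Suc k)) x)"
proof -

  have c: "set_integrable lebesgue (dyadic_cube j0 m) F" if "level_fun j F" "j0 \<le> j" for F :: "real^'n \<Rightarrow> real" and j
    using level_fun_set_integrable_coarse[where g="\<lambda>_. 1", OF that(1) dyadic_cube_set_integrable_const that(2)]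
    unfolding mult_1_right .
  show "set_integrable lebesgue (dyadic_cube j0 m) (\<lambda>x. runmax g j0 k x powr q)"
    by (rule c[OF level_fun_comp[OF level_fun_runmax]]) simp
  show "set_integrable lebesgue (dyadic_cube j0 m) (\<lambda>x. runmax g j0 k x powr (q - 1) * g x)"
    by (rule level_fun_set_integrable_coarse[OF level_fun_comp[OF level_fun_runmax] integrable_1]) simp
  show "set_integrable lebesgue (dyadic_cube j0 m) (\<lambda>x. runmax g j0 k x powr (q - 1) * dyadic_avg g (j0 + int k) x)"
    by (rule c[of "j0 + int k"], rule level_fun_comp2[OF level_fun_runmax level_fun_dyadic_avg]) simp
  have "level_fun (j0 + int (Suc k)) (runmax g j0 k)"
    by (rule level_fun_mono[OF level_fun_runmax]) simp
  then show "set_integrable lebesgue (dyadic_cube j0 m) (\<lambda>x. runmax g j0 k x powr (q - 1) * dyadic_avg g (j0 + int (Suc k)) x)"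
    by (intro c[of "j0 + int (Suc k)"], intro level_fun_comp2[OF _ level_fun_dyadic_avg, where h="\<lambda>u v. u powr (q - 1) * v"])
      simp_all
qed

text \<open>Integrates the pointwise decrease of the potential. Between two steps the current
  average is exchanged for \<open>g\<close>, and \<open>g\<close> for the next average, without
  changing the weighted integral.\<close>

lemma runmax_potential:
  "(LINT x:dyadic_cube j0 m|lebesgue. runmax g j0 k x powr q)
    \<le> q / (q - 1) * (LINT x:dyadic_cube j0 m|lebesgue. runmax g j0 k x powr (q - 1) * g x)"
proof (induction k)
  let ?L = "set_lebesgue_integral lebesgue (dyadic_cube j0 m)"
  have avg: "?L (\<lambda>x. runmax g j0 k x powr (q - 1) * dyadic_avg g (j0 + int k) x)
      = ?L (\<lambda>x. runmax g j0 k x powr (q - 1) * g x)" for k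
    by (rule set_integral_dyadic_avg[OF level_fun_comp[OF level_fun_runmax] integrable_1]) simp
  \<comment> \<open>The maximum up to scale \<open>j0 + k\<close> is also constant on the cubes one
    scale finer, so averages at either scale may replace \<open>g\<close>: the martingale
    property.\<close>
  have avg': "?L (\<lambda>x. runmax g j0 k x powr (q - 1) * dyadic_avg g (j0 + int (Suc k)) x)
      = ?L (\<lambda>x. runmax g j0 k x powr (q - 1) * g x)" for k
  proof (rule set_integral_dyadic_avg[OF _ integrable_1])
    have "level_fun (j0 + int (Suc k)) (runmax g j0 k)"
      by (rule level_fun_mono[OF level_fun_runmax]) simp
    then show "level_fun (j0 + int (Suc k)) (\<lambda>x. runmax g j0 k x powr (q - 1))"
      by (rule level_fun_comp)
  qed simp
  {
    case 0
    \<comment> \<open>Initially maximum and average coincide, and the factor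
      \<open>q / (q - 1)\<close> exceeds 1.\<close>
    have "?L (\<lambda>x. runmax g j0 0 x powr q) = ?L (\<lambda>x. runmax g j0 0 x powr (q - 1) * dyadic_avg g (j0 + int 0) x)"
      using dyadic_avg_nonneg[of j0] by (intro set_lebesgue_integral_cong) (auto simp: powr_diff)
    also have "\<dots> = ?L (\<lambda>x. runmax g j0 0 x powr (q - 1) * g x)" (is "_ = ?R")
      by (rule avg)
    also have "\<dots> \<le> q / (q - 1) * ?R"
    proof (rule mult_right_mono[of 1 "q / (q - 1)" ?R, unfolded mult_1])
      show "0 \<le> ?R"
        unfolding set_lebesgue_integral_def by (intro Bochner_Integration.integral_nonneg) (auto simp: nonneg)
    qed (use q in \<open>auto simp: field_simps\<close>)
    finally show ?case .
  next
    case (Suc k)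
    let ?m = "runmax g j0 k" and ?m' = "runmax g j0 (Suc k)" and ?a = "dyadic_avg g (j0 + int (Suc k))"
    note int = runmax_integrable(1)[of j0 m k] runmax_integrable(4)[of j0 m k]
      runmax_integrable(1,3)[of j0 m "Suc k"]
    have "?L (\<lambda>x. ?m' x powr q) - q / (q - 1) * ?L (\<lambda>x. ?m' x powr (q - 1) * ?a x)
      = ?L (\<lambda>x. ?m' x powr q - q / (q - 1) * (?m' x powr (q - 1) * ?a x))"
      using int by (subst set_integral_diff) (auto simp del: runmax.simps)
    also have "\<dots> \<le> ?L (\<lambda>x. ?m x powr q - q / (q - 1) * (?m x powr (q - 1) * ?a x))"
      using int maximal_potential_step[OF q runmax_nonneg dyadic_avg_nonneg, of j0 k _ "j0 + int (Suc k)"]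
      by (intro set_integral_mono set_integral_diff set_integrable_mult_right) auto
    also have "\<dots> = ?L (\<lambda>x. ?m x powr q) - q / (q - 1) * ?L (\<lambda>x. ?m x powr (q - 1) * ?a x)"
      using int by (subst set_integral_diff) (auto simp del: runmax.simps)
    also have "\<dots> \<le> 0"
      using Suc by (simp only: avg')
    finally show ?case
      by (simp only: avg)
  }
qed

text \<open>Half of the left integral, which is finite, is absorbed; doubling the remaining constant
  \<open>2 powr (q - 1) / (q - 1)\<close> gives the stated one.\<close>

lemma dyadic_maximal_inequality:
  "(LINT x:dyadic_cube j0 m|lebesgue. runmax g j0 k x powr q)
    \<le> 2 powr q / (q - 1) * (LINT x:dyadic_cube j0 m|lebesgue. g x powr q)"
proof -
  let ?L = "set_lebesgue_integral lebesgue (dyadic_cube j0 m)" and ?m = "runmax g j0 k"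
  have "?L (\<lambda>x. ?m x powr q) \<le> q / (q - 1) * ?L (\<lambda>x. ?m x powr (q - 1) * g x)"
    by (rule runmax_potential)
  also have "\<dots> = ?L (\<lambda>x. q / (q - 1) * (?m x powr (q - 1) * g x))"
    by simp
  also have "\<dots> \<le> ?L (\<lambda>x. 1 / 2 * ?m x powr q + 2 powr (q - 1) / (q - 1) * g x powr q)"
    using maximal_absorb[OF q runmax_nonneg nonneg, of j0 k] runmax_integrable(1,2)[of j0 m k] integrable_q[of j0 m]
    by (intro set_integral_mono set_integral_add set_integrable_mult_right) auto
  also have "\<dots> = 1 / 2 * ?L (\<lambda>x. ?m x powr q) + 2 powr (q - 1) / (q - 1) * ?L (\<lambda>x. g x powr q)"
    using runmax_integrable(1)[of j0 m k] integrable_q[of j0 m]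
    by (subst set_integral_add) auto
  finally have "?L (\<lambda>x. ?m x powr q) \<le> 2 * (2 powr (q - 1) / (q - 1) * ?L (\<lambda>x. g x powr q))"
    by simp
  moreover have "2 powr q = 2 * 2 powr (q - 1)"
    by (simp add: powr_diff)
  ultimately show ?thesis
    by simp
qed

text \<open>Monotone convergence, since the maximal bound is uniform in \<open>k\<close>. The
  supremum is taken in \<open>ennreal\<close> because it may be infinite on a null set.\<close>

lemma nn_integral_sup_runmax:
  "(\<integral>\<^sup>+x\<in>dyadic_cube j0 m. (SUP k. ennreal (runmax g j0 k x powr q)) \<partial>lebesgue)
    \<le> ennreal (2 powr q / (q - 1) * (LINT x:dyadic_cube j0 m|lebesgue. g x powr q))"
proof -
  let ?Q = "dyadic_cube j0 m"
  have meas [measurable]: "runmax g j0 k \<in> borel_measurable lebesgue" for k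
    by (intro set_lborel_measurable_lebesgue level_fun_measurable[OF level_fun_runmax])
  have "(\<integral>\<^sup>+x\<in>?Q. (SUP k. ennreal (runmax g j0 k x powr q)) \<partial>lebesgue)
      = (\<integral>\<^sup>+x. (SUP k. ennreal (runmax g j0 k x powr q) * indicator ?Q x) \<partial>lebesgue)"
    by (intro nn_integral_cong) (auto split: split_indicator)
  also have "\<dots> = (SUP k. \<integral>\<^sup>+x\<in>?Q. ennreal (runmax g j0 k x powr q) \<partial>lebesgue)"
  proof (rule nn_integral_monotone_convergence_SUP)
    show "incseq (\<lambda>k x. ennreal (runmax g j0 k x powr q) * indicator ?Q x)"
      using q runmax_mono runmax_nonneg
      by (auto simp: incseq_def le_fun_def intro!: mult_right_mono ennreal_leI powr_mono2)
  qed measurable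
  also have "\<dots> \<le> ennreal (2 powr q / (q - 1) * (LINT x:?Q|lebesgue. g x powr q))"
  proof (rule SUP_least)
    fix k
    have "(\<integral>\<^sup>+x\<in>?Q. ennreal (runmax g j0 k x powr q) \<partial>lebesgue)
        = (\<integral>\<^sup>+x. ennreal (indicator ?Q x *\<^sub>R (runmax g j0 k x powr q)) \<partial>lebesgue)"
      by (intro nn_integral_cong) (auto split: split_indicator)
    also have "\<dots> = ennreal (LINT x:?Q|lebesgue. runmax g j0 k x powr q)"
      unfolding set_lebesgue_integral_def using runmax_integrable(1)[of j0 m k]
      by (intro nn_integral_eq_integral) (auto simp: set_integrable_def)
    also have "\<dots> \<le> ennreal (2 powr q / (q - 1) * (LINT x:?Q|lebesgue. g x powr q))"
      by (intro ennreal_leI dyadic_maximal_inequality)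
    finally show "(\<integral>\<^sup>+x\<in>?Q. ennreal (runmax g j0 k x powr q) \<partial>lebesgue)
        \<le> ennreal (2 powr q / (q - 1) * (LINT x:?Q|lebesgue. g x powr q))" .
  qed
  finally show ?thesis .
qed

end

section \<open>Hedberg summation and Haar functions\<close>

lemma sum_geometric_int_le:
  fixes r :: real and k :: int
  assumes "0 < r" "r < 1" "finite J"
  shows "(\<Sum>j\<in>J. r ^ nat \<bar>j - k\<bar>) \<le> 2 / (1 - r)"
proof -
  \<comment> \<open>Each distance from \<open>k\<close> occurs at most once on either side of
    \<open>k\<close>, so each side is dominated by one geometric series.\<close>
  have *: "(\<Sum>j\<in>A. r ^ nat \<bar>j - k\<bar>) \<le> 1 / (1 - r)" if "finite A" "inj_on (\<lambda>j. nat \<bar>j - k\<bar>) A" for A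
  proof -
    have "(\<Sum>j\<in>A. r ^ nat \<bar>j - k\<bar>) = (\<Sum>i\<in>(\<lambda>j. nat \<bar>j - k\<bar>) ` A. r ^ i)"
      using that by (simp add: sum.reindex)
    also have "\<dots> \<le> (\<Sum>i. r ^ i)"
      using assms that by (intro sum_le_suminf summable_geometric) auto
    also have "\<dots> = 1 / (1 - r)"
      using assms by (intro suminf_geometric) auto
    finally show ?thesis .
  qed
  have "J = {j\<in>J. k \<le> j} \<union> {j\<in>J. j < k}" by auto
  then have "(\<Sum>j\<in>J. r ^ nat \<bar>j - k\<bar>)
      = (\<Sum>j\<in>{j\<in>J. k \<le> j}. r ^ nat \<bar>j - k\<bar>) + (\<Sum>j\<in>{j\<in>J. j < k}. r ^ nat \<bar>j - k\<bar>)"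
    using assms(3) by (subst sum.union_disjoint[symmetric]) (auto intro: sum.cong)
  also have "\<dots> \<le> 1 / (1 - r) + 1 / (1 - r)"
    using assms(3) by (intro add_mono *) (auto simp: inj_on_def)
  finally show ?thesis by simp
qed

text \<open>Hedberg's argument: the two bounds balance at the scale \<open>\<rho>\<close>, and the sum decays geometrically
  away from it.\<close>

lemma Hedberg_sum:
  fixes a b :: real
  assumes "0 < a" "0 < b"
  obtains C where "C > 0"
    "\<And>y S N J. \<lbrakk>finite J; 0 \<le> S; 0 \<le> N;
        \<And>j. j \<in> J \<Longrightarrow> y j \<le> 2 powr (- real_of_int j * a) * S;
        \<And>j. j \<in> J \<Longrightarrow> y j \<le> 2 powr (real_of_int j * b) * N\<rbrakk>
      \<Longrightarrow> (\<Sum>j\<in>J. y j) \<le> C * (S powr (b / (a + b)) * N powr (a / (a + b)))"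
proof -
  \<comment> \<open>The slower of the two decay rates serves on both sides of the balancing
    scale.\<close>
  define c where "c = min a b"
  define r :: real where "r = 2 powr - c"
  have r: "0 < r" "r < 1" and c: "0 < c" "c \<le> a" "c \<le> b"
    using assms by (auto simp: r_def c_def powr_less_one)
  define C where "C = 2 powr c * (2 / (1 - r))"
  have "C > 0" using r by (simp add: C_def)
  moreover have "(\<Sum>j\<in>J. y j) \<le> C * (S powr (b / (a + b)) * N powr (a / (a + b)))"
    if J: "finite J" and SN: "0 \<le> S" "0 \<le> N"
      and y1: "\<And>j. j \<in> J \<Longrightarrow> y j \<le> 2 powr (- real_of_int j * a) * S"
      and y2: "\<And>j. j \<in> J \<Longrightarrow> y j \<le> 2 powr (real_of_int j * b) * N"
    for y and S N :: real and J :: "int set"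
  proof (cases "S = 0 \<or> N = 0")
    \<comment> \<open>The balancing scale is undefined here, but one of the two bounds already makes
      every term nonpositive.\<close>
    case True
    then have "y j \<le> 0" if "j \<in> J" for j
      using y1[OF that] y2[OF that] by auto
    then have "(\<Sum>j\<in>J. y j) \<le> 0"
      by (intro sum_nonpos)
    then show ?thesis
      using True by auto
  next
    case False
    define D where "D = S powr (b / (a + b)) * N powr (a / (a + b))"
    define \<rho> where "\<rho> = log 2 (S / N) / (a + b)"
    have "S / N = 2 powr (\<rho> * (a + b))"
      using False SN assms by (simp add: \<rho>_def)
    then have S: "S = 2 powr (\<rho> * (a + b)) * N"
      using False by (simp add: field_simps)
    have D: "D = 2 powr (\<rho> * b) * N"
    proof -
      have "D = 2 powr (\<rho> * (a + b) * (b / (a + b))) * (N powr (b / (a + b)) * N powr (a / (a + b)))"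
        using SN by (simp add: D_def S powr_mult powr_powr)
      also have "\<rho> * (a + b) * (b / (a + b)) = \<rho> * b"
        using assms by simp
      also have "N powr (b / (a + b)) * N powr (a / (a + b)) = N powr ((a + b) / (a + b))"
        by (simp only: powr_add[symmetric] add_divide_distrib[symmetric] add.commute[of b a])
      also have "\<dots> = N"
        using assms SN by simp
      finally show ?thesis .
    qed
    have "y j \<le> D * 2 powr c * r ^ nat \<bar>j - \<lfloor>\<rho>\<rfloor>\<bar>" if "j \<in> J" for j
    proof -
      have "y j \<le> D * 2 powr (- c * \<bar>real_of_int j - \<rho>\<bar>)"
      proof (cases "\<rho> \<le> real_of_int j")
        case True
        have "y j \<le> 2 powr (- real_of_int j * a) * (2 powr (\<rho> * (a + b)) * N)"
          using y1[OF that] S by simp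
        also have "\<dots> = D * 2 powr (- (a * (real_of_int j - \<rho>)))"
          by (simp add: D powr_add[symmetric] algebra_simps flip: mult.assoc)
        also have "\<dots> \<le> D * 2 powr (- (c * (real_of_int j - \<rho>)))"
          using c True SN by (intro mult_left_mono powr_mono) (auto simp: D mult_right_mono)
        finally show ?thesis using True by simp
      next
        case False
        have "y j \<le> 2 powr (real_of_int j * b) * N"
          using y2[OF that] by simp
        also have "\<dots> = D * 2 powr (- (b * (\<rho> - real_of_int j)))"
          by (simp add: D powr_add[symmetric] algebra_simps flip: mult.assoc)
        also have "\<dots> \<le> D * 2 powr (- (c * (\<rho> - real_of_int j)))"
          using c False SN by (intro mult_left_mono powr_mono) (auto simp: D mult_right_mono)
        finally show ?thesis using False by simp
      qed
      \<comment> \<open>Rounding \<open>\<rho>\<close> to an integer shifts distances by at most 1,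
        at the cost of a factor \<open>2 powr c\<close>.\<close>
      also have "\<dots> \<le> D * 2 powr (c + - c * real (nat \<bar>j - \<lfloor>\<rho>\<rfloor>\<bar>))"
      proof (intro mult_left_mono powr_mono)
        have "real (nat \<bar>j - \<lfloor>\<rho>\<rfloor>\<bar>) \<le> 1 + \<bar>real_of_int j - \<rho>\<bar>"
          by linarith
        from mult_left_mono[OF this, of c] c
        show "- c * \<bar>real_of_int j - \<rho>\<bar> \<le> c + - c * real (nat \<bar>j - \<lfloor>\<rho>\<rfloor>\<bar>)"
          by (simp add: algebra_simps)
      qed (use SN in \<open>auto simp: D\<close>)
      also have "\<dots> = D * 2 powr c * r ^ nat \<bar>j - \<lfloor>\<rho>\<rfloor>\<bar>"
        by (simp add: r_def powr_realpow[symmetric] powr_powr powr_add[symmetric])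
      finally show ?thesis .
    qed
    then have "(\<Sum>j\<in>J. y j) \<le> (\<Sum>j\<in>J. D * 2 powr c * r ^ nat \<bar>j - \<lfloor>\<rho>\<rfloor>\<bar>)"
      by (rule sum_mono)
    also have "\<dots> = D * 2 powr c * (\<Sum>j\<in>J. r ^ nat \<bar>j - \<lfloor>\<rho>\<rfloor>\<bar>)"
      by (simp add: sum_distrib_left)
    also have "\<dots> \<le> D * 2 powr c * (2 / (1 - r))"
      using SN by (intro mult_left_mono sum_geometric_int_le r J) (auto simp: D)
    also have "\<dots> = C * D"
      by (simp add: C_def)
    finally show ?thesis by (simp add: D_def)
  qed
  ultimately show thesis by (rule that)
qed

text \<open>Bounded absolute sums give unconditional summability, and the windows from
  \<open>- M\<close> to \<open>M\<close> eventually contain every finite set of integers.\<close>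

lemma convergent_symmetric_sums:
  fixes a :: "int \<Rightarrow> real"
  assumes "\<And>J. finite J \<Longrightarrow> (\<Sum>j\<in>J. \<bar>a j\<bar>) \<le> B"
  shows "convergent (\<lambda>M. \<Sum>j\<in>{- int M..int M}. a j)"
proof -
  have "(\<lambda>j. norm (a j)) summable_on UNIV"
    by (rule nonneg_bdd_above_summable_on) (auto intro!: bdd_aboveI[of _ B] assms)
  then have "a summable_on UNIV"
    by (rule abs_summable_summable)
  then obtain s where "(sum a \<longlongrightarrow> s) (finite_subsets_at_top UNIV)"
    by (auto simp: summable_on_def has_sum_def)
  moreover have "filterlim (\<lambda>M. {- int M..int M}) (finite_subsets_at_top UNIV) sequentially"
    unfolding filterlim_finite_subsets_at_top
  proof (intro allI impI)
    fix X :: "int set" assume "finite X \<and> X \<subseteq> UNIV"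
    then have "finite (abs ` X)" by simp
    then obtain b where "\<And>x. x \<in> X \<Longrightarrow> \<bar>x\<bar> \<le> b"
      using bdd_above_finite[of "abs ` X"] by (auto simp: bdd_above_def)
    then have "finite {- int M..int M} \<and> X \<subseteq> {- int M..int M} \<and> {- int M..int M} \<subseteq> UNIV"
      if "nat b \<le> M" for M
      using that by fastforce
    then show "\<forall>\<^sub>F M in sequentially. finite {- int M..int M} \<and> X \<subseteq> {- int M..int M} \<and> {- int M..int M} \<subseteq> UNIV"
      by (rule eventually_sequentiallyI)
  qed
  ultimately have "(\<lambda>M. sum a {- int M..int M}) \<longlonglongrightarrow> s"
    by (rule filterlim_compose)
  then show ?thesis by (auto simp: convergent_def)
qed

section \<open>Size and support of Haar functions, and the terms of the series\<close>

lemma haar1_bounds: "\<bar>haar1 e u\<bar> \<le> 1" "haar1 e u \<noteq> 0 \<Longrightarrow> \<lfloor>u\<rfloor> = 0"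
  by (auto simp: haar1_def indicator_def floor_eq_iff of_bool_def split: if_splits)

lemma haar1_measurable [measurable]: "haar1 e \<in> borel_measurable borel"
  unfolding haar1_def by measurable

lemma haar_fun_measurable [measurable]: "haar_fun e j m \<in> borel_measurable borel"
  unfolding haar_fun_def by measurable

lemma haar_fun_eq_0: "cell j x \<noteq> m \<Longrightarrow> haar_fun e j m x = 0"
proof -
  assume "cell j x \<noteq> m"
  then obtain i where i: "\<lfloor>2 powr real_of_int j * x $ i\<rfloor> \<noteq> m i"
    by (auto simp: cell_def fun_eq_iff)
  then have "haar1 (e i) (2 powr real_of_int j * x $ i - real_of_int (m i)) = 0"
    using haar1_bounds(2)[of "e i" "2 powr real_of_int j * x $ i - real_of_int (m i)"] by auto
  then show ?thesis
    unfolding haar_fun_def by (auto intro: prod_zero)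
qed

lemma haar_fun_bound:
  "\<bar>haar_fun e j m (x :: real^'n::finite)\<bar> \<le> 2 powr (real_of_int j * real CARD('n) / 2)"
proof -
  have "\<bar>\<Prod>i\<in>UNIV. haar1 (e i) (2 powr real_of_int j * x $ i - real_of_int (m i))\<bar> \<le> 1"
    unfolding abs_prod by (intro prod_le_1) (auto simp: haar1_bounds)
  then show ?thesis
    unfolding haar_fun_def abs_mult by (simp add: mult_left_le)
qed

lemma pairing_haar_bound:
  fixes f :: "real^'n::finite \<Rightarrow> real"
  assumes "set_integrable lebesgue (dyadic_cube j m) (\<lambda>x. \<bar>f x\<bar>)"
  shows "\<bar>pairing f (haar_fun e j m)\<bar>
    \<le> 2 powr (real_of_int j * real CARD('n) / 2) * (LINT x:dyadic_cube j m|lebesgue. \<bar>f x\<bar>)"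
proof -
  let ?c = "2 powr (real_of_int j * real CARD('n) / 2)"
  have "\<bar>pairing f (haar_fun e j m)\<bar> \<le> (LINT x|lebesgue. \<bar>f x * haar_fun e j m x\<bar>)"
    unfolding pairing_def using integral_norm_bound[of lebesgue "\<lambda>x. f x * haar_fun e j m x"] by simp
  also have "\<dots> \<le> (LINT x|lebesgue. ?c * (indicator (dyadic_cube j m) x *\<^sub>R \<bar>f x\<bar>))"
  proof (rule integral_mono')
    show "integrable lebesgue (\<lambda>x. ?c * (indicator (dyadic_cube j m) x *\<^sub>R \<bar>f x\<bar>))"
      using assms unfolding set_integrable_def by (rule integrable_mult_right)
    fix x :: "real^'n"
    show "\<bar>f x * haar_fun e j m x\<bar> \<le> ?c * (indicator (dyadic_cube j m) x *\<^sub>R \<bar>f x\<bar>)"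
    proof (cases "cell j x = m")
      case True
      then show ?thesis
        using mult_right_mono[OF haar_fun_bound[of e j m x], of "\<bar>f x\<bar>"]
        by (simp add: mem_dyadic_cube_iff abs_mult mult.commute)
    qed (simp add: mem_dyadic_cube_iff haar_fun_eq_0)
  qed simp
  finally show ?thesis
    by (simp add: set_lebesgue_integral_def)
qed

text \<open>At a point \<open>x\<close> only the cube containing \<open>x\<close> contributes at
  scale \<open>j\<close>, which removes the infinite sum; the power of two is the weight
  \<open>|Q|^(\<alpha>/n)\<close>.\<close>

definition level_term :: "real \<Rightarrow> (real^'n::finite \<Rightarrow> real) \<Rightarrow> int \<Rightarrow> real^'n \<Rightarrow> real" where
  "level_term \<alpha> f j x = (\<Sum>e\<in>haar_sigs. 2 powr (- real_of_int j * \<alpha>) *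
     pairing f (haar_fun e j (cell j x)) * haar_fun e j (cell j x) x)"

lemma frac_partial_eq:
  fixes f :: "real^'n::finite \<Rightarrow> real"
  shows "frac_partial \<alpha> f M x = (\<Sum>j\<in>{- int M..int M}. level_term \<alpha> f j x)"
proof -
  have "infsum (\<lambda>m. measure lebesgue (dyadic_cube j m :: (real^'n) set) powr (\<alpha> / real CARD('n)) *
        pairing f (haar_fun e j m) * haar_fun e j m x) UNIV
      = 2 powr (- real_of_int j * \<alpha>) * pairing f (haar_fun e j (cell j x)) * haar_fun e j (cell j x) x"
    for j and e :: "'n \<Rightarrow> bool"
  proof -
    have "infsum (\<lambda>m. measure lebesgue (dyadic_cube j m :: (real^'n) set) powr (\<alpha> / real CARD('n)) *
        pairing f (haar_fun e j m) * haar_fun e j m x) UNIV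
      = infsum (\<lambda>m. 2 powr (- real_of_int j * \<alpha>) * pairing f (haar_fun e j m) * haar_fun e j m x) {cell j x}"
      by (rule infsum_cong_neutral) (auto simp: haar_fun_eq_0 measure_dyadic_cube powr_powr)
    then show ?thesis by simp
  qed
  then show ?thesis
    unfolding frac_partial_def level_term_def by (simp add: sum.swap[of _ haar_sigs])
qed

lemma level_term_measurable: "level_term \<alpha> f j \<in> borel_measurable borel"
  unfolding level_term_def
proof (intro borel_measurable_sum)
  fix e :: "'a \<Rightarrow> bool"
  show "(\<lambda>x. 2 powr (- real_of_int j * \<alpha>) * pairing f (haar_fun e j (cell j x)) * haar_fun e j (cell j x) x)
      \<in> borel_measurable borel"
    \<comment> \<open>The index depends on \<open>x\<close> through a countably-valued map; for each
      fixed index the expression is Borel.\<close>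
    by (rule measurable_compose_countable[where g="cell j"]) measurable
qed

text \<open>The normalisation of the Haar function enters twice, through the coefficient and through
  the value at \<open>x\<close>; the product is \<open>1/|Q|\<close> and turns the integral into an
  average.\<close>

lemma level_term_bound:
  fixes f :: "real^'n::finite \<Rightarrow> real"
  assumes "\<And>m. set_integrable lebesgue (dyadic_cube j m) (\<lambda>x. \<bar>f x\<bar>)"
  shows "\<bar>level_term \<alpha> f j x\<bar>
    \<le> real (card (haar_sigs :: ('n \<Rightarrow> bool) set)) * (2 powr (- real_of_int j * \<alpha>) * dyadic_avg (\<lambda>x. \<bar>f x\<bar>) j x)"
proof -
  let ?c = "2 powr (real_of_int j * real CARD('n) / 2)" and ?I = "LINT x:dyadic_cube j (cell j x)|lebesgue. \<bar>f x\<bar>"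
  have "\<bar>2 powr (- real_of_int j * \<alpha>) * pairing f (haar_fun e j (cell j x)) * haar_fun e j (cell j x) x\<bar>
    \<le> 2 powr (- real_of_int j * \<alpha>) * dyadic_avg (\<lambda>x. \<bar>f x\<bar>) j x" for e
  proof -
    have "\<bar>pairing f (haar_fun e j (cell j x))\<bar> * \<bar>haar_fun e j (cell j x) x\<bar> \<le> (?c * ?I) * ?c"
      by (rule mult_mono'[OF pairing_haar_bound[OF assms] haar_fun_bound]) simp_all
    also have "\<dots> = dyadic_avg (\<lambda>x. \<bar>f x\<bar>) j x"
      by (simp add: dyadic_avg_def powr_add[symmetric])
    finally show ?thesis
      by (simp add: abs_mult mult.assoc)
  qed
  then show ?thesis
    unfolding level_term_def by (intro order_trans[OF sum_abs] sum_bounded_above)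
qed

section \<open>Morrey spaces\<close>

lemma morrey_vals_cube_le:
  fixes f :: "real^'n::finite \<Rightarrow> real"
  assumes "f \<in> morrey_space p q"
  shows "(2 powr (- real_of_int j * real CARD('n))) powr (1 / p - 1 / q) *
      (LINT x:dyadic_cube j m|lebesgue. \<bar>f x\<bar> powr q) powr (1 / q) \<le> morrey_norm p q f"
  unfolding morrey_norm_def
proof (rule cSup_upper)
  have "dyadic_cube j m \<in> (dyadic_cubes :: (real^'n) set set)"
    by (auto simp: dyadic_cubes_def)
  then show "(2 powr (- real_of_int j * real CARD('n))) powr (1 / p - 1 / q) *
      (LINT x:dyadic_cube j m|lebesgue. \<bar>f x\<bar> powr q) powr (1 / q) \<in> morrey_vals p q f"
    unfolding morrey_vals_def by (rule rev_image_eqI) (simp add: measure_dyadic_cube)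
qed (use assms in \<open>simp add: morrey_space_def\<close>)

lemma morrey_norm_nonneg:
  assumes "f \<in> morrey_space p q"
  shows "0 \<le> morrey_norm p q f"
  by (rule order_trans[OF _ morrey_vals_cube_le[OF assms]]) simp

text \<open>The Morrey condition solved for the integral: at most \<open>N^q |Q|^(1 - q/p)\<close>
  with \<open>N\<close> the norm.\<close>

lemma morrey_cube_integral_le:
  fixes f :: "real^'n::finite \<Rightarrow> real"
  assumes f: "f \<in> morrey_space p q" and q: "0 < q"
  shows "(LINT x:dyadic_cube j m|lebesgue. \<bar>f x\<bar> powr q)
    \<le> morrey_norm p q f powr q * 2 powr (- real_of_int j * real CARD('n) * (1 - q / p))"
proof -
  let ?I = "LINT x:dyadic_cube j m|lebesgue. \<bar>f x\<bar> powr q" and ?N = "morrey_norm p q f"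
  define V :: real where "V = 2 powr (- real_of_int j * real CARD('n))"
  have V: "V > 0" by (simp add: V_def)
  have I: "0 \<le> ?I"
    unfolding set_lebesgue_integral_def by (intro Bochner_Integration.integral_nonneg) simp
  have "V powr (1 / q - 1 / p) * (V powr (1 / p - 1 / q) * ?I powr (1 / q)) \<le> V powr (1 / q - 1 / p) * ?N"
    using morrey_vals_cube_le[OF f, of j m] by (intro mult_left_mono) (simp_all add: V_def)
  also have "V powr (1 / q - 1 / p) * (V powr (1 / p - 1 / q) * ?I powr (1 / q)) = ?I powr (1 / q)"
    using V by (simp add: powr_add[symmetric] flip: mult.assoc)
  finally have "(?I powr (1 / q)) powr q \<le> (V powr (1 / q - 1 / p) * ?N) powr q"
    using q by (intro powr_mono2) auto
  also have "(?I powr (1 / q)) powr q = ?I"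
    using q I by (simp add: powr_powr)
  also have "(V powr (1 / q - 1 / p) * ?N) powr q = ?N powr q * V powr (1 - q / p)"
    using q morrey_norm_nonneg[OF f] by (simp add: powr_mult powr_powr left_diff_distrib)
  also have "V powr (1 - q / p) = 2 powr (- real_of_int j * real CARD('n) * (1 - q / p))"
    by (simp add: V_def powr_powr)
  finally show ?thesis .
qed

lemma dyadic_Lq_morrey:
  fixes f :: "real^'n::finite \<Rightarrow> real"
  assumes f: "f \<in> morrey_space p q" and q: "1 < q"
  shows "dyadic_Lq (\<lambda>x. \<bar>f x\<bar>) q"
proof
  have f': "f \<in> borel_measurable lebesgue"
    "\<And>K. compact K \<Longrightarrow> set_integrable lebesgue K (\<lambda>x. \<bar>f x\<bar> powr q)"
    using f by (auto simp: morrey_space_def Lq_loc_def)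
  fix j and m :: "'n \<Rightarrow> int"
  obtain K where "compact K" "(dyadic_cube j m :: (real^'n) set) \<subseteq> K"
    using dyadic_cube_subset_compact by blast
  then show "set_integrable lebesgue (dyadic_cube j m) (\<lambda>x. \<bar>f x\<bar> powr q)"
    by (intro set_integrable_subset[OF f'(2)]) simp_all
  show "(\<lambda>x. \<bar>f x\<bar>) \<in> borel_measurable lebesgue"
    using f'(1) by measurable
qed (use q in auto)

text \<open>By Jensen and the preceding cube bound, the \<open>q\<close>-th power of the average is
  at most \<open>N^q |Q|^(-q/p)\<close>.\<close>

lemma morrey_avg_le:
  fixes f :: "real^'n::finite \<Rightarrow> real"
  assumes f: "f \<in> morrey_space p q" and q: "1 < q"
  shows "dyadic_avg (\<lambda>x. \<bar>f x\<bar>) j x \<le> 2 powr (real_of_int j * (real CARD('n) / p)) * morrey_norm p q f"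
proof -
  interpret dyadic_Lq "\<lambda>x. \<bar>f x\<bar>" q
    by (rule dyadic_Lq_morrey[OF assms])
  let ?A = "dyadic_avg (\<lambda>x. \<bar>f x\<bar>) j x" and ?N = "morrey_norm p q f"
  let ?e = "real_of_int j * real CARD('n)"
  have "?A powr q \<le> 2 powr ?e * (LINT x:dyadic_cube j (cell j x)|lebesgue. \<bar>f x\<bar> powr q)"
    using dyadic_avg_powr_le[of j x] by (simp add: dyadic_avg_def)
  also have "\<dots> \<le> 2 powr ?e * (?N powr q * 2 powr (- real_of_int j * real CARD('n) * (1 - q / p)))"
    using q by (intro mult_left_mono morrey_cube_integral_le f) auto
  also have "\<dots> = (2 powr ?e * 2 powr (- real_of_int j * real CARD('n) * (1 - q / p))) * ?N powr q"
    by simp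
  also have "2 powr ?e * 2 powr (- real_of_int j * real CARD('n) * (1 - q / p))
      = (2 powr (real_of_int j * (real CARD('n) / p))) powr q"
    by (simp add: powr_powr powr_add[symmetric] algebra_simps)
  also have "\<dots> * ?N powr q = (2 powr (real_of_int j * (real CARD('n) / p)) * ?N) powr q"
    using morrey_norm_nonneg[OF f] by (simp add: powr_mult)
  finally have "?A powr q \<le> (2 powr (real_of_int j * (real CARD('n) / p)) * ?N) powr q" .
  then show ?thesis
    using q dyadic_avg_nonneg morrey_norm_nonneg[OF f]
    by (meson leD leI less_le_trans mult_nonneg_nonneg powr_ge_zero powr_less_mono2 zero_less_one order.strict_trans)
qed

text \<open>Converse of \<open>morrey_cube_integral_le\<close>. The bound is on the nonnegative
  integral, so its finiteness supplies integrability as well; compact sets are covered by finitely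
  many unit cubes.\<close>

lemma morrey_spaceI:
  fixes g :: "real^'n::finite \<Rightarrow> real"
  assumes t: "0 < t" and K: "0 \<le> K" and g [measurable]: "g \<in> borel_measurable lebesgue"
    and le: "\<And>j m. (\<integral>\<^sup>+x\<in>dyadic_cube j m. ennreal (\<bar>g x\<bar> powr t) \<partial>lebesgue)
      \<le> ennreal (K powr t * 2 powr (- real_of_int j * real CARD('n) * (1 - t / s)))"
  shows "g \<in> morrey_space s t" "morrey_norm s t g \<le> K"
proof -
  have nn: "(\<integral>\<^sup>+x. ennreal (indicator (dyadic_cube j m) x *\<^sub>R \<bar>g x\<bar> powr t) \<partial>lebesgue)
      = (\<integral>\<^sup>+x\<in>dyadic_cube j m. ennreal (\<bar>g x\<bar> powr t) \<partial>lebesgue)" for j m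
    by (intro nn_integral_cong) (auto split: split_indicator)
  have int: "set_integrable lebesgue (dyadic_cube j m) (\<lambda>x. \<bar>g x\<bar> powr t)" for j m
    unfolding set_integrable_def
  proof (rule integrableI_nonneg)
    show "(\<integral>\<^sup>+x. ennreal (indicator (dyadic_cube j m) x *\<^sub>R \<bar>g x\<bar> powr t) \<partial>lebesgue) < \<infinity>"
      unfolding nn by (rule le_less_trans[OF le]) simp
  qed auto
  have "set_integrable lebesgue S (\<lambda>x. \<bar>g x\<bar> powr t)" if "compact S" for S
  proof (rule set_integrable_subset)
    show "set_integrable lebesgue (\<Union>m\<in>cell 0 ` S. dyadic_cube 0 m) (\<lambda>x. \<bar>g x\<bar> powr t)"
      using that by (intro set_integrable_UN int cell_bounded_finite compact_imp_bounded dyadic_cube_lebesgue)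
    show "S \<in> sets lebesgue"
      using that by (simp add: compact_imp_closed)
    show "S \<subseteq> (\<Union>m\<in>cell 0 ` S. dyadic_cube 0 m)"
      by (auto simp: mem_dyadic_cube_iff)
  qed
  then have Lq: "g \<in> Lq_loc t"
    by (auto simp: Lq_loc_def)
  have val: "v \<le> K" if v: "v \<in> morrey_vals s t g" for v
  proof -
    obtain j and m :: "'n \<Rightarrow> int" where v: "v = measure lebesgue (dyadic_cube j m :: (real^'n) set) powr (1/s - 1/t) *
       (LINT x:dyadic_cube j m|lebesgue. \<bar>g x\<bar> powr t) powr (1/t)"
      using v by (auto simp: morrey_vals_def dyadic_cubes_def)
    let ?I = "LINT x:dyadic_cube j m|lebesgue. \<bar>g x\<bar> powr t"
    define V :: real where "V = 2 powr (- real_of_int j * real CARD('n))"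
    have V: "V > 0" by (simp add: V_def)
    have I: "0 \<le> ?I"
      unfolding set_lebesgue_integral_def by (intro Bochner_Integration.integral_nonneg) simp
    have "ennreal ?I = (\<integral>\<^sup>+x\<in>dyadic_cube j m. ennreal (\<bar>g x\<bar> powr t) \<partial>lebesgue)"
      unfolding set_lebesgue_integral_def nn[symmetric]
      using int[of j m] by (intro nn_integral_eq_integral[symmetric]) (auto simp: set_integrable_def)
    also have "\<dots> \<le> ennreal (K powr t * V powr (1 - t / s))"
      using le[of j m] by (simp add: V_def powr_powr)
    finally have "?I \<le> K powr t * V powr (1 - t / s)"
      by (subst (asm) ennreal_le_iff) auto
    then have "?I powr (1 / t) \<le> (K powr t * V powr (1 - t / s)) powr (1 / t)"
      using t I by (intro powr_mono2) auto
    also have "\<dots> = K * V powr ((1 - t / s) * (1 / t))"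
      using t K by (simp add: powr_mult powr_powr)
    also have "(1 - t / s) * (1 / t) = 1 / t - 1 / s"
      using t by (simp add: diff_divide_distrib)
    finally have "V powr (1 / s - 1 / t) * ?I powr (1 / t) \<le> V powr (1 / s - 1 / t) * (K * V powr (1 / t - 1 / s))"
      by (intro mult_left_mono) auto
    also have "\<dots> = K * V powr ((1 / s - 1 / t) + (1 / t - 1 / s))"
      by (simp only: powr_add) simp
    also have "\<dots> = K"
      using V by simp
    finally show ?thesis
      by (simp add: v measure_dyadic_cube V_def)
  qed
  then have "bdd_above (morrey_vals s t g)"
    by (intro bdd_aboveI[of _ K])
  with Lq show "g \<in> morrey_space s t"
    by (simp add: morrey_space_def)
  \<comment> \<open>A real \<open>Sup\<close> inherits an upper bound only from a nonempty
    set.\<close>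
  have "morrey_vals s t g \<noteq> {}"
    by (auto simp: morrey_vals_def dyadic_cubes_def)
  then show "morrey_norm s t g \<le> K"
    unfolding morrey_norm_def using val by (intro cSup_least)
qed

text \<open>Partial sums are Borel, and so is their pointwise \<open>lim\<close>, which takes a
  fixed default value where the sequence diverges.\<close>

lemma frac_dyadic_measurable: "frac_dyadic \<alpha> f \<in> borel_measurable borel"
proof -
  have "frac_partial \<alpha> f M \<in> borel_measurable borel" for M
    unfolding frac_partial_eq[abs_def] by (intro borel_measurable_sum level_term_measurable)
  then show ?thesis
    unfolding frac_dyadic_def[abs_def] by (rule borel_measurable_lim_metric)
qed

section \<open>Morrey bounds for the dyadic fractional integral\<close>

theorem theorem3:
  fixes \<alpha> p q s t :: real
  assumes "0 < \<alpha>" "\<alpha> < real CARD('n::finite)"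
    and "1 < q" "q \<le> p" "1 < t" "t \<le> s"
    and "1 / s = 1 / p - \<alpha> / real CARD('n)"
    and "t / s = q / p"
  shows "\<exists>C>0. \<forall>f \<in> (morrey_space p q :: (real^'n \<Rightarrow> real) set).
           (AE x in lebesgue. convergent (\<lambda>M. frac_partial \<alpha> f M x))
         \<and> frac_dyadic \<alpha> f \<in> morrey_space s t
         \<and> morrey_norm s t (frac_dyadic \<alpha> f) \<le> C * morrey_norm p q f"
proof -
  define n where "n = real CARD('n)"
  have n: "n > 0" by (simp add: n_def)
  have ps: "0 < p" "0 < s" "0 < n / s" using assms n by auto
  \<comment> \<open>Hedberg's lemma is used with rates \<alpha> and \<open>n / s\<close>; their sum
    \<open>n / p\<close> produces the exponents \<open>p / s\<close> and
    \<open>1 - p / s\<close>.\<close>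
  have sum: "\<alpha> + n / s = n / p"
    using assms(7) n unfolding n_def[symmetric] by (simp add: field_simps)
  then have e1: "(n / s) / (\<alpha> + n / s) = p / s" and e2: "\<alpha> / (\<alpha> + n / s) = 1 - p / s"
    using n ps assms(1) by (simp, simp add: eq_diff_eq) (simp add: field_simps)
  \<comment> \<open>The ratio hypothesis makes the \<open>t\<close>-th power of Hedberg's bound
    contain exactly the \<open>q\<close>-th power of the maximal function.\<close>
  have tq: "t * (p / s) = q" "t * (1 - p / s) = t - q"
    using assms(8) ps by (auto simp: field_simps)
  obtain C0 where C0: "C0 > 0"
    and Hedberg: "\<And>y S N J. \<lbrakk>finite J; 0 \<le> S; 0 \<le> N;
        \<And>j. j \<in> J \<Longrightarrow> y j \<le> 2 powr (- real_of_int j * \<alpha>) * S;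
        \<And>j. j \<in> J \<Longrightarrow> y j \<le> 2 powr (real_of_int j * (n / s)) * N\<rbrakk>
      \<Longrightarrow> (\<Sum>j\<in>J. y j) \<le> C0 * (S powr (p / s) * N powr (1 - p / s))"
    using Hedberg_sum[OF assms(1) ps(3)] unfolding e1 e2 by metis
  define c where "c = real (card (haar_sigs :: ('n \<Rightarrow> bool) set)) * C0"
  have c: "c \<ge> 0" using C0 by (simp add: c_def)
  define B where "B = 2 powr q / (q - 1)"
  have B: "B \<ge> 0" using assms(3) by (simp add: B_def)
  \<comment> \<open>Under the root, 1 accounts for cubes containing \<open>Q\<close> and
    \<open>B\<close>, the constant from Doob's inequality, for subcubes.\<close>
  define C where "C = c * (1 + B) powr (1 / t)"
  have C: "C \<ge> 0" using c by (simp add: C_def)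
  have main: "(AE x in lebesgue. convergent (\<lambda>M. frac_partial \<alpha> f M x))
         \<and> frac_dyadic \<alpha> f \<in> morrey_space s t
         \<and> morrey_norm s t (frac_dyadic \<alpha> f) \<le> C * morrey_norm p q f"
    if f: "f \<in> morrey_space p q" for f :: "real^'n \<Rightarrow> real"
  proof -
    define N where "N = morrey_norm p q f"
    have N: "N \<ge> 0" unfolding N_def by (rule morrey_norm_nonneg[OF f])
    let ?g = "\<lambda>x. \<bar>f x\<bar>"
    interpret dyadic_Lq ?g q
      by (rule dyadic_Lq_morrey[OF f assms(3)])
    have avg: "dyadic_avg ?g j x \<le> 2 powr (real_of_int j * (n / p)) * N" for j x
      unfolding n_def N_def by (rule morrey_avg_le[OF f assms(3)])

    have bound: "(\<Sum>j\<in>J. \<bar>level_term \<alpha> f j x\<bar>) \<le> c * (S powr (p / s) * N powr (1 - p / s))"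
      if S: "\<And>j. dyadic_avg ?g j x \<le> S" and J: "finite J" for x S J
    proof -
      have "(\<Sum>j\<in>J. \<bar>level_term \<alpha> f j x\<bar>)
          \<le> (\<Sum>j\<in>J. real (card (haar_sigs :: ('n \<Rightarrow> bool) set)) * (2 powr (- real_of_int j * \<alpha>) * dyadic_avg ?g j x))"
        by (intro sum_mono level_term_bound integrable_1)
      also have "\<dots> = real (card (haar_sigs :: ('n \<Rightarrow> bool) set)) * (\<Sum>j\<in>J. 2 powr (- real_of_int j * \<alpha>) * dyadic_avg ?g j x)"
        by (simp add: sum_distrib_left)
      also have "\<dots> \<le> real (card (haar_sigs :: ('n \<Rightarrow> bool) set)) * (C0 * (S powr (p / s) * N powr (1 - p / s)))"
      proof (rule mult_left_mono, rule Hedberg[OF J _ N])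
        show "0 \<le> S" using S[of 0] dyadic_avg_nonneg[of 0 x] by linarith
        fix j
        show "2 powr (- real_of_int j * \<alpha>) * dyadic_avg ?g j x \<le> 2 powr (- real_of_int j * \<alpha>) * S"
          by (intro mult_left_mono S) simp
        have "2 powr (- real_of_int j * \<alpha>) * dyadic_avg ?g j x
            \<le> 2 powr (- real_of_int j * \<alpha>) * (2 powr (real_of_int j * (n / p)) * N)"
          by (intro mult_left_mono avg) simp
        also have "\<dots> = 2 powr (real_of_int j * (n / s)) * N"
          unfolding sum[symmetric] by (simp add: powr_add[symmetric] algebra_simps flip: mult.assoc)
        finally show "2 powr (- real_of_int j * \<alpha>) * dyadic_avg ?g j x \<le> 2 powr (real_of_int j * (n / s)) * N" .
      qed simp
      finally show ?thesis by (simp add: c_def)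
    qed
    have conv: "convergent (\<lambda>M. frac_partial \<alpha> f M x)"
      "\<bar>frac_dyadic \<alpha> f x\<bar> \<le> c * (S powr (p / s) * N powr (1 - p / s))"
      if S: "\<And>j. dyadic_avg ?g j x \<le> S" for x S
    proof -
      show *: "convergent (\<lambda>M. frac_partial \<alpha> f M x)"
        unfolding frac_partial_eq by (rule convergent_symmetric_sums[OF bound[OF S]])
      then have "(\<lambda>M. frac_partial \<alpha> f M x) \<longlonglongrightarrow> frac_dyadic \<alpha> f x"
        by (simp add: frac_dyadic_def convergent_LIMSEQ_iff)
      then have "(\<lambda>M. \<bar>frac_partial \<alpha> f M x\<bar>) \<longlonglongrightarrow> \<bar>frac_dyadic \<alpha> f x\<bar>"
        by (rule tendsto_rabs)
      then show "\<bar>frac_dyadic \<alpha> f x\<bar> \<le> c * (S powr (p / s) * N powr (1 - p / s))"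
        by (rule LIMSEQ_le_const2)
          (auto simp: frac_partial_eq intro!: exI[of _ 0] order_trans[OF sum_abs] bound S)
    qed

    \<comment> \<open>The \<open>q\<close>-th power of the maximal function over cubes of side at
      most \<open>2^(-j)\<close>.\<close>
    define U where "U j x = (SUP k. ennreal (runmax ?g j k x powr q))" for j x
    have [measurable]: "runmax ?g j k \<in> borel_measurable lebesgue" for j k
      by (intro set_lborel_measurable_lebesgue level_fun_measurable[OF level_fun_runmax])
    have [measurable]: "U j \<in> borel_measurable lebesgue" for j
      unfolding U_def by measurable
    have U_int: "(\<integral>\<^sup>+x\<in>dyadic_cube j m. U j x \<partial>lebesgue)
        \<le> ennreal (B * N powr q * 2 powr (- real_of_int j * n * (1 - q / p)))" for j m
    proof -
      have "(\<integral>\<^sup>+x\<in>dyadic_cube j m. U j x \<partial>lebesgue) \<le> ennreal (B * (LINT x:dyadic_cube j m|lebesgue. \<bar>f x\<bar> powr q))"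
        unfolding U_def B_def by (rule nn_integral_sup_runmax)
      also have "\<dots> \<le> ennreal (B * (N powr q * 2 powr (- real_of_int j * n * (1 - q / p))))"
        using morrey_cube_integral_le[OF f, of j m] assms(3) B
        by (intro ennreal_leI mult_left_mono) (auto simp: N_def n_def)
      finally show ?thesis by (simp add: mult.assoc)
    qed
    have U_finite: "AE x in lebesgue. x \<in> dyadic_cube j m \<longrightarrow> U j x \<noteq> \<infinity>" for j m
    proof -
      have "(\<integral>\<^sup>+x\<in>dyadic_cube j m. U j x \<partial>lebesgue) \<noteq> \<infinity>"
        using U_int[of j m] by (auto simp: top_unique)
      then have "AE x in lebesgue. U j x * indicator (dyadic_cube j m) x \<noteq> \<infinity>"
        by (intro nn_integral_PInf_AE) measurable
      then show ?thesis by eventually_elim auto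
    qed
    \<comment> \<open>Scales finer than \<open>j0\<close> are controlled by \<open>U j0\<close>. For
      coarser ones the Morrey bound on averages increases with the scale index, so its value at
      \<open>j0\<close> suffices.\<close>
    have S: "dyadic_avg ?g j x \<le> max (2 powr (real_of_int j0 * (n / p)) * N) (enn2real (U j0 x) powr (1 / q))"
      if fin: "U j0 x \<noteq> \<infinity>" for j0 j x
    proof (cases "j0 \<le> j")
      case True
      have "dyadic_avg ?g j x powr q \<le> runmax ?g j0 (nat (j - j0)) x powr q"
        using dyadic_avg_le_runmax[of "nat (j - j0)" "nat (j - j0)" ?g j0 x] True assms(3) dyadic_avg_nonneg
        by (intro powr_mono2) auto
      also have "\<dots> \<le> enn2real (U j0 x)"
      proof -
        have "ennreal (runmax ?g j0 (nat (j - j0)) x powr q) \<le> U j0 x"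
          unfolding U_def by (rule SUP_upper) simp
        then show ?thesis
          using fin enn2real_mono[of "ennreal (runmax ?g j0 (nat (j - j0)) x powr q)" "U j0 x"]
          by (simp add: less_top)
      qed
      finally have "(dyadic_avg ?g j x powr q) powr (1 / q) \<le> enn2real (U j0 x) powr (1 / q)"
        using assms(3) by (intro powr_mono2) auto
      then show ?thesis
        using assms(3) dyadic_avg_nonneg[of j x] by (simp add: powr_powr)
    next
      case False
      have "2 powr (real_of_int j * (n / p)) * N \<le> 2 powr (real_of_int j0 * (n / p)) * N"
        using False N n ps by (intro mult_right_mono powr_mono) (auto simp: divide_right_mono)
      with avg[of j x] show ?thesis by linarith
    qed

    \<comment> \<open>Countably many unit cubes cover the space, so one null set serves for all of
      them.\<close>
    have "AE x in lebesgue. \<forall>m. x \<in> dyadic_cube 0 m \<longrightarrow> U 0 x \<noteq> \<infinity>"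
      by (rule AE_all_countable[THEN iffD2, rule_format, OF U_finite])
    then have "AE x in lebesgue. convergent (\<lambda>M. frac_partial \<alpha> f M x)"
    proof eventually_elim
      case (elim x)
      then have "U 0 x \<noteq> \<infinity>" by (auto simp: mem_dyadic_cube_iff)
      from conv(1)[OF S[OF this]] show ?case .
    qed
    moreover have le: "(\<integral>\<^sup>+x\<in>dyadic_cube j m. ennreal (\<bar>frac_dyadic \<alpha> f x\<bar> powr t) \<partial>lebesgue)
      \<le> ennreal ((C * N) powr t * 2 powr (- real_of_int j * real CARD('n) * (1 - t / s)))" for j m
    proof -
      let ?Q = "dyadic_cube j m :: (real^'n) set"
      \<comment> \<open>\<open>a\<close> is the \<open>q\<close>-th power of the bound for cubes
        containing \<open>Q\<close>; \<open>b\<close> collects the factors of the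
        \<open>t\<close>-th power of Hedberg's bound that do not depend on \<open>x\<close>.\<close>
      define a where "a = 2 powr (real_of_int j * (n * (q / p))) * N powr q"
      define b where "b = c powr t * N powr (t - q)"
      have ab: "a \<ge> 0" "b \<ge> 0" by (simp_all add: a_def b_def)
      have pt: "ennreal (\<bar>frac_dyadic \<alpha> f x\<bar> powr t) \<le> ennreal b * (ennreal a + U j x)" if fin: "U j x \<noteq> \<infinity>" for x
      proof -
        let ?u = "enn2real (U j x)" and ?v = "2 powr (real_of_int j * (n / p)) * N"
        define S where "S = max ?v (?u powr (1 / q))"
        have "S \<ge> 0" by (simp add: S_def le_max_iff_disj)
        have "S powr q \<le> a + ?u"
        proof (cases "?v \<le> ?u powr (1 / q)")
          case True
          then have "S powr q = ?u" using assms(3) by (simp add: S_def max_absorb2 powr_powr)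
          then show ?thesis using ab by simp
        next
          case False
          then have "S powr q = a" using N by (simp add: S_def max_absorb1 powr_mult powr_powr a_def mult.assoc)
          then show ?thesis by simp
        qed
        have "\<bar>frac_dyadic \<alpha> f x\<bar> powr t \<le> (c * (S powr (p / s) * N powr (1 - p / s))) powr t"
          using conv(2)[OF S[OF fin]] assms(5) unfolding S_def[symmetric] by (intro powr_mono2) auto
        also have "\<dots> = b * S powr q"
          using c by (simp add: powr_mult powr_powr b_def mult.commute[of _ t] tq(2) tq(1)[unfolded times_divide_eq_right])
        also have "\<dots> \<le> b * (a + ?u)"
          using ab by (intro mult_left_mono \<open>S powr q \<le> a + ?u\<close>)
        finally have "ennreal (\<bar>frac_dyadic \<alpha> f x\<bar> powr t) \<le> ennreal (b * (a + ?u))"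
          by (rule ennreal_leI)
        also have "\<dots> = ennreal b * (ennreal a + U j x)"
          using ab fin by (simp add: ennreal_mult ennreal_plus less_top)
        finally show ?thesis .
      qed
      have "(\<integral>\<^sup>+x\<in>?Q. ennreal (\<bar>frac_dyadic \<alpha> f x\<bar> powr t) \<partial>lebesgue)
          \<le> (\<integral>\<^sup>+x. ennreal b * (ennreal a * indicator ?Q x + U j x * indicator ?Q x) \<partial>lebesgue)"
      proof (rule nn_integral_mono_AE)
        show "AE x in lebesgue. ennreal (\<bar>frac_dyadic \<alpha> f x\<bar> powr t) * indicator ?Q x
            \<le> ennreal b * (ennreal a * indicator ?Q x + U j x * indicator ?Q x)"
          using U_finite[of j m] by eventually_elim (auto simp: pt split: split_indicator)
      qed
      also have "\<dots> = ennreal b * ((\<integral>\<^sup>+x. ennreal a * indicator ?Q x \<partial>lebesgue) + (\<integral>\<^sup>+x\<in>?Q. U j x \<partial>lebesgue))"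
        by (subst nn_integral_cmult, measurable) (subst nn_integral_add, measurable)
      also have "(\<integral>\<^sup>+x. ennreal a * indicator ?Q x \<partial>lebesgue) = ennreal (a * 2 powr (- real_of_int j * n))"
        using ab by (simp add: nn_integral_cmult_indicator emeasure_dyadic_cube n_def ennreal_mult)
      \<comment> \<open>The contribution of the larger cubes has the same form
        \<open>N^q |Q|^(1 - q/p)\<close> as Doob's bound for the subcubes, so the two add up to the
        factor \<open>1 + B\<close>.\<close>
      also have "a * 2 powr (- real_of_int j * n) = N powr q * 2 powr (- real_of_int j * n * (1 - q / p))"
        unfolding a_def by (simp add: powr_add[symmetric] algebra_simps)
      also have "ennreal b * (ennreal (N powr q * 2 powr (- real_of_int j * n * (1 - q / p))) + (\<integral>\<^sup>+x\<in>?Q. U j x \<partial>lebesgue))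
          \<le> ennreal b * (ennreal (N powr q * 2 powr (- real_of_int j * n * (1 - q / p)))
            + ennreal (B * N powr q * 2 powr (- real_of_int j * n * (1 - q / p))))"
        by (intro mult_left_mono add_left_mono U_int) simp
      also have "\<dots> = ennreal (b * (N powr q * 2 powr (- real_of_int j * n * (1 - q / p))
            + B * N powr q * 2 powr (- real_of_int j * n * (1 - q / p))))"
        using ab B by (simp add: ennreal_mult ennreal_plus)
      also have "b * (N powr q * 2 powr (- real_of_int j * n * (1 - q / p))
            + B * N powr q * 2 powr (- real_of_int j * n * (1 - q / p)))
          = c powr t * (1 + B) * (N powr (t - q) * N powr q) * 2 powr (- real_of_int j * n * (1 - q / p))"
        by (simp add: b_def algebra_simps)
      also have "N powr (t - q) * N powr q = N powr t"
        by (simp add: powr_add[symmetric])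
      also have "c powr t * (1 + B) * N powr t = (C * N) powr t"
        using assms(5) B N c by (simp add: C_def powr_mult powr_powr)
      finally show ?thesis
        unfolding n_def assms(8) .
    qed
    ultimately show ?thesis
      using morrey_spaceI[where K="C * N" and s=s and t=t,
          OF _ _ set_lborel_measurable_lebesgue[OF frac_dyadic_measurable] le] assms(5) C N
      by (simp add: N_def)
  qed
  show ?thesis
  \<comment> \<open>Adding 1 turns the established \<open>C \<ge> 0\<close> into a positive
    constant.\<close>
  proof (intro exI[of _ "C + 1"] conjI ballI)
    show "C + 1 > 0" using C by simp
    fix f :: "real^'n \<Rightarrow> real" assume f: "f \<in> morrey_space p q"
    note m = main[OF f]
    show "AE x in lebesgue. convergent (\<lambda>M. frac_partial \<alpha> f M x)" "frac_dyadic \<alpha> f \<in> morrey_space s t"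
      using m by auto
    show "morrey_norm s t (frac_dyadic \<alpha> f) \<le> (C + 1) * morrey_norm p q f"
      using m morrey_norm_nonneg[OF f] by (simp add: distrib_right)
  qed
qed

end
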